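(* For $1\le i\le n-1$ and $0\le m\le N$, shape invariance determines the eigenpolynomial $\mathcal P^{(i)}_m$ of $\widetilde{\mathcal H}^{(i)}$ and its eigenvalue $\mathcal E_i(m)$. Explicitly, $$\mathcal P^{(i)}_m=\mathcal P^{(i)}_m(x_i,x_{>i};a_i,a_{>i})=\sum_{k=0}^m(-1)^k\binom mk(a_{>i}+k)_{m-k}(a_i+m-k)_k(-x_i)_{m-k}(-x_{>i})_k,$$ $$\widetilde{\mathcal H}_i\mathcal P^{(i)}_m=\widetilde{\mathcal H}^{(i)}\mathcal P^{(i)}_m=\mathcal E_i(m)\mathcal P^{(i)}_m,\qquad\mathcal E_i(m)=m(m+a_i+a_{>i}-1).$$ They are orthogonal with each other: $(\mathcal P^{(i)}_m,\mathcal P^{(i)}_{m'})=0$ for $m\ne m'$. Moreover $$\widetilde{\mathcal H}_j\mathcal P^{(i)}_m=0\quad\text{for } j>i,$$ and consequently $$(\mathcal P^{(i)}_m,\mathcal P^{(j)}_m)=0,\qquad i\ne j.$$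
   Context: Fix integers $N>n\ge2$ and real parameters $a_1,\ldots,a_n>0$, $b>0$; $|a|=\sum_{i=1}^na_i$. For $\boldsymbol x=(x_1,\ldots,x_n)$, $|x|=\sum_{i=1}^nx_i$; $\mathcal X=\{\boldsymbol x\in\mathbb N_0^n:|x|\le N\}$; $\boldsymbol e_j$ is the $j$-th unit vector; $(c)_k=c(c+1)\cdots(c+k-1)$, $(c)_0=1$. For $1\le i\le n-1$: $x_{>i}=x_{i+1}+\cdots+x_n$, $a_{>i}=a_{i+1}+\cdots+a_n$. Polynomials are taken of total degree at most $N$. For $i=1,\ldots,n-1$, on polynomials in $\boldsymbol x$, $$\widetilde{\mathcal H}_ip(\boldsymbol x)=\sum_{\substack{i\le j,k\le n\\ j\ne k}}x_j(x_k+a_k)\bigl(p(\boldsymbol x)-p(\boldsymbol x-\boldsymbol e_j+\boldsymbol e_k)\bigr).$$ On polynomials $p(x_i,x_{>i})$ in the two variables $x_i,x_{>i}$, its restriction is denoted $\widetilde{\mathcal H}^{(i)}$: $$\widetilde{\mathcal H}^{(i)}p(x_i,x_{>i})=x_i(x_{>i}+a_{>i})\bigl(p(x_i,x_{>i})-p(x_i-1,x_{>i}+1)\bigr)+x_{>i}(x_i+a_i)\bigl(p(x_i,x_{>i})-p(x_i+1,x_{>i}-1)\bigr).$$ Inner product: $(p,q)=\sum_{\boldsymbol x\in\mathcal X}p(\boldsymbol x)q(\boldsymbol x)W(\boldsymbol x)$ with $$W(\boldsymbol x)=\frac{N!}{x_1!\cdots x_n!\,(N-|x|)!}\,\frac{\prod_{i=1}^n(a_i)_{x_i}\,(b)_{N-|x|}}{(|a|+b)_N}.$$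 Shape invariance: put $b'=b+|a|-a_i-a_{>i}$, $\boldsymbol\lambda=(a_i,a_{>i},b',N)$, $\boldsymbol\delta=(1,1,0,-1)$, and let $\phi_0^{(i)}(\boldsymbol x;\boldsymbol\lambda)$ be the square root of $$W^{(i)}=\frac{N!}{x_i!\,x_{>i}!\,(N-x_i-x_{>i})!}\,\frac{(a_i)_{x_i}(a_{>i})_{x_{>i}}(b')_{N-x_i-x_{>i}}}{(|a|+b)_N}.$$ With $e^{\pm\partial_i}$, $e^{\pm\partial_{>i}}$ the shifts of $x_i$, $x_{>i}$ by $\pm1$, let $$\mathcal B(\boldsymbol\lambda)=e^{\partial_{>i}}\sqrt{x_{>i}(x_i+a_i)}-e^{\partial_i}\sqrt{x_i(x_{>i}+a_{>i})},\qquad \mathcal B(\boldsymbol\lambda)^T=\sqrt{x_{>i}(x_i+a_i)}\,e^{-\partial_{>i}}-\sqrt{x_i(x_{>i}+a_{>i})}\,e^{-\partial_i}.$$ Then $\phi_0^{(i)}\widetilde{\mathcal H}^{(i)}(\phi_0^{(i)})^{-1}=\mathcal B(\boldsymbol\lambda)^T\mathcal B(\boldsymbol\lambda)$ and $\mathcal B(\boldsymbol\lambda)\phi_0^{(i)}(\boldsymbol x;\boldsymbol\lambda)=0$. Shape invariance is the relation $$\mathcal B(\boldsymbol\lambda)\mathcal B(\boldsymbol\lambda)^T=\mathcal B(\boldsymbol\lambda+\boldsymbol\delta)^T\mathcal B(\boldsymbol\lambda+\boldsymbol\delta)+a_i+a_{>i}.$$ It determines the eigenvalue as $\sum_{s=0}^{m-1}(a_i+a_{>i}+2s)$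 and the eigenpolynomial, up to normalisation, through $\mathcal P^{(i)}_m\,\phi_0^{(i)}(\boldsymbol x;\boldsymbol\lambda)\propto\mathcal B(\boldsymbol\lambda)^T\mathcal B(\boldsymbol\lambda+\boldsymbol\delta)^T\cdots\mathcal B(\boldsymbol\lambda+(m-1)\boldsymbol\delta)^T\phi_0^{(i)}(\boldsymbol x;\boldsymbol\lambda+m\boldsymbol\delta)$.
   Formalization: The final orthogonality of the m-th eigenpolynomials with indices i ≠ j is stated only for 1 ≤ m ≤ N; at m = 0 both polynomials equal 1 and their inner product is the sum of the positive weights W, hence nonzero. *)

theory Defs
  imports Complex_Main
begin

text \<open>
  Points \<open>(x\<^sub>1, \<dots>, x\<^sub>n)\<close> are functions on \<open>nat\<close> of which only the
  values at \<open>1, \<dots>, n\<close> matter. Polynomials are represented by the functions they induce on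
  real points, so identities between polynomials are required at all real points, not only on
  the lattice.
\<close>

definition total :: "nat \<Rightarrow> (nat \<Rightarrow> 'a::comm_monoid_add) \<Rightarrow> 'a" where
  "total n x = (\<Sum>l = 1..n. x l)"

text \<open>\<open>tail n x i\<close> is \<open>x\<^sub>>\<^sub>i\<close>; applied to the parameters it gives \<open>a\<^sub>>\<^sub>i\<close>.\<close>

definition tail :: "nat \<Rightarrow> (nat \<Rightarrow> 'a::comm_monoid_add) \<Rightarrow> nat \<Rightarrow> 'a" where
  "tail n x i = (\<Sum>l = Suc i..n. x l)"

definition unit_vec :: "nat \<Rightarrow> nat \<Rightarrow> real" where
  "unit_vec j = (\<lambda>l. if l = j then 1 else 0)"

definition Htilde ::
  "nat \<Rightarrow> (nat \<Rightarrow> real) \<Rightarrow> nat \<Rightarrow> ((nat \<Rightarrow> real) \<Rightarrow> real) \<Rightarrow> (nat \<Rightarrow> real) \<Rightarrow> real" where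
  "Htilde n a i p x =
    (\<Sum>j = i..n. \<Sum>k \<in> {i..n} - {j}.
      x j * (x k + a k) * (p x - p (\<lambda>l. x l - unit_vec j l + unit_vec k l)))"

text \<open>
  The restricted operator in the two variables \<open>x = x\<^sub>i\<close>, \<open>y = x\<^sub>>\<^sub>i\<close>, with
  \<open>\<alpha> = a\<^sub>i\<close>, \<open>\<beta> = a\<^sub>>\<^sub>i\<close>; \<open>lift2 n i\<close> reads a function of these two variables as a function of
  the whole vector.
\<close>

definition Htilde2 ::
  "real \<Rightarrow> real \<Rightarrow> (real \<Rightarrow> real \<Rightarrow> real) \<Rightarrow> real \<Rightarrow> real \<Rightarrow> real" where
  "Htilde2 \<alpha> \<beta> p x y =
     x * (y + \<beta>) * (p x y - p (x - 1) (y + 1)) +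
     y * (x + \<alpha>) * (p x y - p (x + 1) (y - 1))"

definition lift2 :: "nat \<Rightarrow> nat \<Rightarrow> (real \<Rightarrow> real \<Rightarrow> real) \<Rightarrow> (nat \<Rightarrow> real) \<Rightarrow> real" where
  "lift2 n i p x = p (x i) (tail n x i)"

definition poly2_degree_le :: "nat \<Rightarrow> (real \<Rightarrow> real \<Rightarrow> real) \<Rightarrow> bool" where
  "poly2_degree_le d p \<longleftrightarrow>
     (\<exists>c :: nat \<Rightarrow> nat \<Rightarrow> real. \<forall>x y. p x y = (\<Sum>j\<le>d. \<Sum>k\<le>d - j. c j k * x ^ j * y ^ k))"

definition is_eigenpolynomial ::
  "nat \<Rightarrow> ((real \<Rightarrow> real \<Rightarrow> real) \<Rightarrow> real \<Rightarrow> real \<Rightarrow> real) \<Rightarrow> (real \<Rightarrow> real \<Rightarrow> real) \<Rightarrow> real \<Rightarrow> bool" where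
  "is_eigenpolynomial d L p E \<longleftrightarrow>
     poly2_degree_le d p \<and> (\<exists>x y. p x y \<noteq> 0) \<and> (\<forall>x y. L p x y = E * p x y)"

definition eigpoly :: "nat \<Rightarrow> real \<Rightarrow> real \<Rightarrow> real \<Rightarrow> real \<Rightarrow> real" where
  "eigpoly m \<alpha> \<beta> x y =
     (\<Sum>k\<le>m. (-1) ^ k * real (m choose k)
        * pochhammer (\<beta> + real k) (m - k) * pochhammer (\<alpha> + real m - real k) k
        * pochhammer (- x) (m - k) * pochhammer (- y) k)"

definition eigval :: "nat \<Rightarrow> real \<Rightarrow> real \<Rightarrow> real" where
  "eigval m \<alpha> \<beta> = real m * (real m + \<alpha> + \<beta> - 1)"

text \<open>The polynomial of index \<open>(i, m)\<close> as a polynomial in all variables.\<close>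

definition PP :: "nat \<Rightarrow> (nat \<Rightarrow> real) \<Rightarrow> nat \<Rightarrow> nat \<Rightarrow> (nat \<Rightarrow> real) \<Rightarrow> real" where
  "PP n a i m = lift2 n i (eigpoly m (a i) (tail n a i))"

text \<open>
  Lattice points are normalised to vanish outside \<open>{1..n}\<close>, which makes the lattice a finite
  set in bijection with its counterpart in \<open>\<nat>\<^sup>n\<close>.
\<close>

definition grid :: "nat \<Rightarrow> nat \<Rightarrow> (nat \<Rightarrow> nat) set" where
  "grid n N = {x. (\<forall>l. l \<notin> {1..n} \<longrightarrow> x l = 0) \<and> total n x \<le> N}"

definition weight :: "nat \<Rightarrow> nat \<Rightarrow> (nat \<Rightarrow> real) \<Rightarrow> real \<Rightarrow> (nat \<Rightarrow> nat) \<Rightarrow> real" where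
  "weight n N a b x =
     fact N / ((\<Prod>l = 1..n. fact (x l)) * fact (N - total n x))
     * ((\<Prod>l = 1..n. pochhammer (a l) (x l)) * pochhammer b (N - total n x)
        / pochhammer (total n a + b) N)"

definition inner_prod ::
  "nat \<Rightarrow> nat \<Rightarrow> (nat \<Rightarrow> real) \<Rightarrow> real \<Rightarrow> ((nat \<Rightarrow> real) \<Rightarrow> real) \<Rightarrow> ((nat \<Rightarrow> real) \<Rightarrow> real) \<Rightarrow> real" where
  "inner_prod n N a b p q =
     (\<Sum>x \<in> grid n N. p (\<lambda>l. real (x l)) * q (\<lambda>l. real (x l)) * weight n N a b x)"

text \<open>
  Parameters \<open>\<lambda> = (a\<^sub>i, a\<^sub>>\<^sub>i, b', N)\<close>, and \<open>shift_par s \<lambda> = \<lambda> + s\<delta>\<close> with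
  \<open>\<delta> = (1, 1, 0, -1)\<close>. The last component is a natural number, so \<open>shift_par s\<close>
  has this meaning only for \<open>s \<le> N\<close>.
\<close>

type_synonym par = "real \<times> real \<times> real \<times> nat"

definition par :: "nat \<Rightarrow> nat \<Rightarrow> (nat \<Rightarrow> real) \<Rightarrow> real \<Rightarrow> nat \<Rightarrow> par" where
  "par n N a b i = (a i, tail n a i, b + total n a - a i - tail n a i, N)"

fun shift_par :: "nat \<Rightarrow> par \<Rightarrow> par" where
  "shift_par s (\<alpha>, \<beta>, b', N) = (\<alpha> + real s, \<beta> + real s, b', N - s)"

text \<open>
  The ground state on the two-variable lattice. At the unshifted parameters
  \<open>\<alpha> + \<beta> + b'\<close> is \<open>|a| + b\<close>. Outside \<open>x + y \<le> N\<close> the value is \<open>0\<close>, as usual for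
  the reciprocal factorial of a negative integer.
\<close>

fun phi0 :: "par \<Rightarrow> nat \<Rightarrow> nat \<Rightarrow> real" where
  "phi0 (\<alpha>, \<beta>, b', N) x y =
     (if x + y \<le> N then
        sqrt (fact N / (fact x * fact y * fact (N - x - y))
          * (pochhammer \<alpha> x * pochhammer \<beta> y * pochhammer b' (N - x - y)
             / pochhammer (\<alpha> + \<beta> + b') N))
      else 0)"

text \<open>
  The operators act on functions on \<open>\<nat>\<^sup>2\<close>. In \<open>Bop\<close> the forward shift stands to the left of
  the square root, so it also shifts the root. In \<open>BopT\<close> the truncated subtraction
  is harmless: at \<open>y = 0\<close> (\<open>x = 0\<close>) the coefficient of the affected term vanishes.
\<close>

fun Bop :: "par \<Rightarrow> (nat \<Rightarrow> nat \<Rightarrow> real) \<Rightarrow> nat \<Rightarrow> nat \<Rightarrow> real" where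
  "Bop (\<alpha>, \<beta>, b', N) f x y =
     sqrt (real (y + 1) * (real x + \<alpha>)) * f x (y + 1)
     - sqrt (real (x + 1) * (real y + \<beta>)) * f (x + 1) y"

fun BopT :: "par \<Rightarrow> (nat \<Rightarrow> nat \<Rightarrow> real) \<Rightarrow> nat \<Rightarrow> nat \<Rightarrow> real" where
  "BopT (\<alpha>, \<beta>, b', N) f x y =
     sqrt (real y * (real x + \<alpha>)) * f x (y - 1)
     - sqrt (real x * (real y + \<beta>)) * f (x - 1) y"

text \<open>\<open>B(\<lambda>)\<^sup>T B(\<lambda> + \<delta>)\<^sup>T \<dots> B(\<lambda> + (m - 1)\<delta>)\<^sup>T \<phi>\<^sub>0(\<lambda> + m\<delta>)\<close> with \<open>\<theta>\<close> for \<open>\<lambda>\<close>; the factor with index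
  \<open>0\<close> is applied last.\<close>

definition ladder_state :: "nat \<Rightarrow> par \<Rightarrow> nat \<Rightarrow> nat \<Rightarrow> real" where
  "ladder_state m \<theta> = foldr (\<lambda>s. BopT (shift_par s \<theta>)) [0..<m] (phi0 (shift_par m \<theta>))"

text \<open>\<open>\<phi>\<^sub>0 H \<phi>\<^sub>0\<^sup>-\<^sup>1 = B\<^sup>T B\<close> on functions on \<open>{(x, y). x + y \<le> N}\<close>, where \<open>\<phi>\<^sub>0 > 0\<close>,
  with an arbitrary such function written as \<open>\<phi>\<^sub>0 p\<close>.\<close>

fun factorisation :: "par \<Rightarrow> bool" where
  "factorisation (\<alpha>, \<beta>, b', N) \<longleftrightarrow>
     (\<forall>p x y. x + y \<le> N \<longrightarrow>
        phi0 (\<alpha>, \<beta>, b', N) x y * Htilde2 \<alpha> \<beta> p (real x) (real y) =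
        BopT (\<alpha>, \<beta>, b', N)
          (Bop (\<alpha>, \<beta>, b', N)
            (\<lambda>x y. phi0 (\<alpha>, \<beta>, b', N) x y * p (real x) (real y))) x y)"

fun shape_invariance :: "par \<Rightarrow> bool" where
  "shape_invariance (\<alpha>, \<beta>, b', N) \<longleftrightarrow>
     (\<forall>f x y. Bop (\<alpha>, \<beta>, b', N) (BopT (\<alpha>, \<beta>, b', N) f) x y =
        BopT (shift_par 1 (\<alpha>, \<beta>, b', N)) (Bop (shift_par 1 (\<alpha>, \<beta>, b', N)) f) x y
        + (\<alpha> + \<beta>) * f x y)"

end

theory Submission
  imports Defs
begin

text \<open>
  Everything about one index \<open>i\<close> comes from a factorisation of the two-variable operator by
  plain difference operators. With \<open>D p (x, y) = p (x, y + 1) - p (x + 1, y)\<close> and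
  \<open>R q (x, y) = y (x + \<alpha>) q (x, y - 1) - x (y + \<beta>) q (x - 1, y)\<close> one has \<open>H = R D\<close> and
  \<open>D R = H' + \<alpha> + \<beta>\<close>, where \<open>H'\<close> is \<open>H\<close> at the parameters \<open>\<alpha> + 1\<close>, \<open>\<beta> + 1\<close>
  (\<open>Htilde2_eq_raise_lower\<close>, \<open>lower_raise\<close>). This is shape invariance freed of square roots,
  and it holds at all real points. So if \<open>q\<close> is an eigenfunction of \<open>H'\<close> with eigenvalue \<open>E\<close>,
  then \<open>R q\<close> is one of \<open>H\<close> with eigenvalue \<open>E + \<alpha> + \<beta>\<close>. A Pascal-type recursion
  (\<open>eigpoly_Suc\<close>) shows that the explicit polynomials are exactly what iterating \<open>R\<close> on the
  constant \<open>1\<close> produces, and the eigenvalue equation follows by induction on the degree.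

  The square-root operators \<open>B\<close> and \<open>B\<^sup>T\<close> are, up to one scalar, the conjugates of \<open>D\<close> and \<open>R\<close>
  by the ground states at the original and the shifted parameters (\<open>Bop_gauge\<close>,
  \<open>BopT_gauge\<close>). Both rest on a single ratio identity for the ground state, \<open>phi0_step_y\<close>. The
  factorisation \<open>B\<^sup>T B\<close>, the annihilation of the ground state and the
  proportionality of ladder states and polynomials are then read off from the polynomial side.

  In all variables, moving a unit between two entries beyond position \<open>i\<close> changes neither
  \<open>x\<^sub>i\<close> nor \<open>x\<^sub>>\<^sub>i\<close>. Hence the operator of index \<open>i\<close> acts on functions of these two quantities
  through the two-variable operator, and every operator of larger index annihilates them.
  Orthogonality follows because these operators are self-adjoint: the rate of
  a move times the weight is symmetric under reversing the move (\<open>weight_move\<close>).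
  For equal indices the eigenvalues \<open>m (m + \<alpha> + \<beta> - 1)\<close> are distinct. For \<open>i < j\<close> the operator of
  index \<open>j\<close> has eigenvalue \<open>0\<close> on one polynomial and a positive eigenvalue on the other as soon
  as \<open>m > 0\<close>.
\<close>

section \<open>Raising and lowering operators on polynomials\<close>

definition lower_op :: "(real \<Rightarrow> real \<Rightarrow> real) \<Rightarrow> real \<Rightarrow> real \<Rightarrow> real" where
  "lower_op p x y = p x (y + 1) - p (x + 1) y"

definition raise_op ::
  "real \<Rightarrow> real \<Rightarrow> (real \<Rightarrow> real \<Rightarrow> real) \<Rightarrow> real \<Rightarrow> real \<Rightarrow> real" where
  "raise_op \<alpha> \<beta> q x y = y * (x + \<alpha>) * q x (y - 1) - x * (y + \<beta>) * q (x - 1) y"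

lemma Htilde2_eq_raise_lower: "Htilde2 \<alpha> \<beta> p = raise_op \<alpha> \<beta> (lower_op p)"
  by (intro ext) (simp add: Htilde2_def raise_op_def lower_op_def algebra_simps)

text \<open>Shape invariance in its polynomial form; the two parameters increase by one.\<close>

lemma lower_raise:
  "lower_op (raise_op \<alpha> \<beta> q) x y = Htilde2 (\<alpha> + 1) (\<beta> + 1) q x y + (\<alpha> + \<beta>) * q x y"
  by (simp add: Htilde2_def raise_op_def lower_op_def algebra_simps)

lemma sum_choose_Suc_split:
  fixes t :: "nat \<Rightarrow> real"
  shows "(\<Sum>k\<le>Suc m. real (Suc m choose k) * t k) =
    (\<Sum>k\<le>m. real (m choose k) * t k) + (\<Sum>k\<le>m. real (m choose k) * t (Suc k))"
proof -
  have "(\<Sum>k\<le>m. real (m choose k) * t k) = (\<Sum>k\<le>Suc m. real (m choose k) * t k)"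
    by simp
  also have "\<dots> = t 0 + (\<Sum>k\<le>m. real (m choose Suc k) * t (Suc k))"
    by (subst sum.atMost_Suc_shift) simp
  finally show ?thesis
    by (subst sum.atMost_Suc_shift) (simp add: algebra_simps sum.distrib)
qed

text \<open>
  In \<open>y (x + \<alpha>) (-x)\<^sub>j\<close> the factor \<open>x + \<alpha>\<close> is \<open>(\<alpha> + j) - (j - x)\<close>: the first part completes a
  Pochhammer symbol in \<open>\<alpha>\<close>, the second one in \<open>-x\<close>. Likewise for \<open>y + \<beta>\<close>. The two
  parts of the second kind cancel, and the other two are the two halves of Pascal's rule.
\<close>

lemma eigpoly_Suc:
  "eigpoly (Suc m) \<alpha> \<beta> = raise_op \<alpha> \<beta> (eigpoly m (\<alpha> + 1) (\<beta> + 1))"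
proof (intro ext)
  fix x y :: real
  define X where "X j = pochhammer (- x) j" for j
  define Y where "Y j = pochhammer (- y) j" for j
  define c where "c k = (-1) ^ k * real (m choose k)
    * pochhammer (\<beta> + 1 + real k) (m - k) * pochhammer (\<alpha> + 1 + real m - real k) k" for k
  define t where "t k = (-1) ^ k * pochhammer (\<beta> + real k) (Suc m - k)
    * pochhammer (\<alpha> + real (Suc m) - real k) k * X (Suc m - k) * Y k" for k
  have poch_Suc: "pochhammer (- z) (Suc j) = pochhammer (- z) j * (real j - z)"
    "pochhammer (- z) (Suc j) = - z * pochhammer (- (z - 1)) j" for j and z :: real
    using pochhammer_rec[of "- z" j] by (simp_all add: pochhammer_Suc add.commute)
  note X_Suc = poch_Suc[of x, folded X_def] and Y_Suc = poch_Suc[of y, folded Y_def]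
  have term_eq: "c k * (y * (x + \<alpha>) * (X (m - k) * pochhammer (- (y - 1)) k))
      - c k * (x * (y + \<beta>) * (pochhammer (- (x - 1)) (m - k) * Y k))
      = real (m choose k) * t k + real (m choose k) * t (Suc k)" if "k \<le> m" for k
  proof -
    have "y * (x + \<alpha>) * (X (m - k) * pochhammer (- (y - 1)) k)
        = - (x + \<alpha>) * X (m - k) * Y (Suc k)"
      by (simp add: Y_Suc(2) algebra_simps)
    also have "\<dots> = X (Suc (m - k)) * Y (Suc k) - (\<alpha> + real (m - k)) * X (m - k) * Y (Suc k)"
      by (simp add: X_Suc(1) algebra_simps)
    finally have 1: "y * (x + \<alpha>) * (X (m - k) * pochhammer (- (y - 1)) k) = \<dots>" .
    have "x * (y + \<beta>) * (pochhammer (- (x - 1)) (m - k) * Y k)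
        = - (y + \<beta>) * X (Suc (m - k)) * Y k"
      by (simp add: X_Suc(2) algebra_simps)
    also have "\<dots> = X (Suc (m - k)) * Y (Suc k) - (\<beta> + real k) * X (Suc (m - k)) * Y k"
      by (simp add: Y_Suc(1) algebra_simps)
    finally have 2: "x * (y + \<beta>) * (pochhammer (- (x - 1)) (m - k) * Y k) = \<dots>" .
    have 3: "real (m choose k) * t k = c k * ((\<beta> + real k) * X (Suc (m - k)) * Y k)"
      using that by (simp add: t_def c_def Suc_diff_le pochhammer_rec algebra_simps)
    have "pochhammer (\<alpha> + real m - real k) (Suc k)
        = (\<alpha> + real (m - k)) * pochhammer (\<alpha> + 1 + real m - real k) k"
      using that by (simp add: pochhammer_rec of_nat_diff algebra_simps)
    hence 4: "real (m choose k) * t (Suc k)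
        = - c k * ((\<alpha> + real (m - k)) * X (m - k) * Y (Suc k))"
      by (simp add: t_def c_def algebra_simps)
    show ?thesis unfolding 1 2 3 4 by (simp add: algebra_simps)
  qed
  have "eigpoly (Suc m) \<alpha> \<beta> x y = (\<Sum>k\<le>Suc m. real (Suc m choose k) * t k)"
    unfolding eigpoly_def t_def X_def Y_def by (intro sum.cong) (simp_all add: mult_ac)
  also have "\<dots> = (\<Sum>k\<le>m. real (m choose k) * t k + real (m choose k) * t (Suc k))"
    by (simp only: sum_choose_Suc_split sum.distrib)
  also have "\<dots> = (\<Sum>k\<le>m. c k * (y * (x + \<alpha>) * (X (m - k) * pochhammer (- (y - 1)) k))
      - c k * (x * (y + \<beta>) * (pochhammer (- (x - 1)) (m - k) * Y k)))"
    by (intro sum.cong) (simp_all only: term_eq atMost_iff)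
  also have "\<dots> = raise_op \<alpha> \<beta> (eigpoly m (\<alpha> + 1) (\<beta> + 1)) x y"
    unfolding raise_op_def eigpoly_def c_def X_def Y_def sum_subtractf sum_distrib_left
    by (intro arg_cong2[of _ _ _ _ minus] sum.cong) (simp_all add: mult_ac)
  finally show "eigpoly (Suc m) \<alpha> \<beta> x y = raise_op \<alpha> \<beta> (eigpoly m (\<alpha> + 1) (\<beta> + 1)) x y" .
qed

text \<open>
  The recursion for the eigenvalues is \<open>E\<^sub>m\<^sub>+\<^sub>1(\<alpha>, \<beta>) = E\<^sub>m(\<alpha> + 1, \<beta> + 1) + \<alpha> + \<beta>\<close>.
\<close>

lemma Htilde2_eigpoly: "Htilde2 \<alpha> \<beta> (eigpoly m \<alpha> \<beta>) x y = eigval m \<alpha> \<beta> * eigpoly m \<alpha> \<beta> x y"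
proof (induction m arbitrary: \<alpha> \<beta> x y)
  case 0
  show ?case by (simp add: Htilde2_def eigpoly_def eigval_def)
next
  case (Suc m)
  let ?q = "eigpoly m (\<alpha> + 1) (\<beta> + 1)"
  have "lower_op (raise_op \<alpha> \<beta> ?q) = (\<lambda>x y. eigval (Suc m) \<alpha> \<beta> * ?q x y)"
    by (intro ext) (simp add: lower_raise Suc.IH eigval_def algebra_simps)
  hence "Htilde2 \<alpha> \<beta> (eigpoly (Suc m) \<alpha> \<beta>) x y
      = raise_op \<alpha> \<beta> (\<lambda>x y. eigval (Suc m) \<alpha> \<beta> * ?q x y) x y"
    by (simp only: Htilde2_eq_raise_lower eigpoly_Suc)
  thus ?case by (simp only: eigpoly_Suc) (simp add: raise_op_def algebra_simps)
qed

lemma sum_eigval: "(\<Sum>s<m. \<alpha> + \<beta> + 2 * real s) = eigval m \<alpha> \<beta>"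
  by (induction m) (simp_all add: eigval_def algebra_simps)

section \<open>Degree and nonvanishing of the eigenpolynomials\<close>

lemma poly2_degree_le_monom:
  assumes "i + j \<le> d"
  shows "poly2_degree_le d (\<lambda>x y. c * x ^ i * y ^ j)"
proof -
  have "(\<Sum>r\<le>d. \<Sum>s\<le>d - r. (if r = i \<and> s = j then c else 0) * x ^ r * y ^ s)
      = c * x ^ i * y ^ j" for x y :: real
  proof -
    have "(\<Sum>r\<le>d. \<Sum>s\<le>d - r. (if r = i \<and> s = j then c else 0) * x ^ r * y ^ s)
        = (\<Sum>r\<le>d. if r = i then c * x ^ i * y ^ j else 0)"
    proof (intro sum.cong refl)
      fix r
      have "(\<Sum>s\<le>d - r. (if r = i \<and> s = j then c else 0) * x ^ r * y ^ s)
          = (\<Sum>s\<le>d - r. if s = j then (if r = i then c * x ^ i * y ^ j else 0) else 0)"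
        by (intro sum.cong) auto
      also have "\<dots> = (if r = i then c * x ^ i * y ^ j else 0)"
        using assms by auto
      finally show "(\<Sum>s\<le>d - r. (if r = i \<and> s = j then c else 0) * x ^ r * y ^ s) = \<dots>" .
    qed
    thus ?thesis using assms by simp
  qed
  thus ?thesis unfolding poly2_degree_le_def
    by (intro exI[of _ "\<lambda>r s. if r = i \<and> s = j then c else 0"]) simp
qed

lemma poly2_degree_le_sum:
  assumes "\<And>s. s \<in> S \<Longrightarrow> poly2_degree_le d (p s)"
  shows "poly2_degree_le d (\<lambda>x y. \<Sum>s\<in>S. p s x y)"
proof -
  have "\<forall>s\<in>S. \<exists>c. \<forall>x y. p s x y = (\<Sum>j\<le>d. \<Sum>k\<le>d - j. c j k * x ^ j * y ^ k)"
    using assms unfolding poly2_degree_le_def by blast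
  from bchoice[OF this] obtain c where c: "\<And>s x y. s \<in> S \<Longrightarrow>
      p s x y = (\<Sum>j\<le>d. \<Sum>k\<le>d - j. c s j k * x ^ j * y ^ k)"
    by blast
  have "(\<Sum>s\<in>S. p s x y) = (\<Sum>j\<le>d. \<Sum>k\<le>d - j. (\<Sum>s\<in>S. c s j k) * x ^ j * y ^ k)" for x y
  proof -
    have "(\<Sum>s\<in>S. p s x y) = (\<Sum>s\<in>S. \<Sum>j\<le>d. \<Sum>k\<le>d - j. c s j k * x ^ j * y ^ k)"
      by (simp add: c)
    also have "\<dots> = (\<Sum>j\<le>d. \<Sum>k\<le>d - j. \<Sum>s\<in>S. c s j k * x ^ j * y ^ k)"
      by (subst sum.swap, intro sum.cong refl, subst sum.swap) (rule refl)
    finally show ?thesis by (simp add: sum_distrib_right)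
  qed
  thus ?thesis unfolding poly2_degree_le_def by (intro exI[of _ "\<lambda>j k. \<Sum>s\<in>S. c s j k"]) simp
qed

lemma pochhammer_minus_poly:
  "\<exists>c. \<forall>x::real. pochhammer (- x) m = (\<Sum>i\<le>m. c i * x ^ i)"
proof (induction m)
  case 0
  show ?case by (intro exI[of _ "\<lambda>_. 1"]) simp
next
  case (Suc m)
  then obtain c where c: "\<And>x::real. pochhammer (- x) m = (\<Sum>i\<le>m. c i * x ^ i)" by blast
  define d where "d i = (if i \<le> m then real m * c i else 0) - (if i = 0 then 0 else c (i - 1))"
    for i
  have "pochhammer (- x) (Suc m) = (\<Sum>i\<le>Suc m. d i * x ^ i)" for x :: real
  proof -
    have "(\<Sum>i\<le>Suc m. d i * x ^ i)
        = (\<Sum>i\<le>Suc m. (if i \<le> m then real m * c i else 0) * x ^ i)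
          - (\<Sum>i\<le>Suc m. (if i = 0 then 0 else c (i - 1)) * x ^ i)"
      by (simp only: d_def left_diff_distrib sum_subtractf)
    also have "(\<Sum>i\<le>Suc m. (if i \<le> m then real m * c i else 0) * x ^ i)
        = real m * (\<Sum>i\<le>m. c i * x ^ i)"
      by (simp add: sum_distrib_left mult_ac)
    also have "(\<Sum>i\<le>Suc m. (if i = 0 then 0 else c (i - 1)) * x ^ i) = x * (\<Sum>i\<le>m. c i * x ^ i)"
      by (subst sum.atMost_Suc_shift) (simp add: sum_distrib_left mult_ac)
    finally show ?thesis by (simp add: pochhammer_Suc c[symmetric] algebra_simps)
  qed
  thus ?case by blast
qed

lemma poly2_degree_le_eigpoly:
  assumes "m \<le> d"
  shows "poly2_degree_le d (eigpoly m \<alpha> \<beta>)"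
proof -
  have "\<forall>m. \<exists>c. \<forall>x::real. pochhammer (- x) m = (\<Sum>i\<le>m. c i * x ^ i)"
    by (intro allI pochhammer_minus_poly)
  from choice[OF this]
  obtain c where c: "\<And>m x::real. pochhammer (- x) m = (\<Sum>i\<le>m. c m i * x ^ i)"
    by blast
  define e where "e k = (-1) ^ k * real (m choose k)
    * pochhammer (\<beta> + real k) (m - k) * pochhammer (\<alpha> + real m - real k) k" for k
  have "eigpoly m \<alpha> \<beta>
      = (\<lambda>x y. \<Sum>k\<le>m. \<Sum>i\<le>m - k. \<Sum>j\<le>k. e k * c (m - k) i * c k j * x ^ i * y ^ j)"
    unfolding eigpoly_def e_def[symmetric] c
    by (intro ext sum.cong refl)
      (simp add: sum_distrib_left sum_distrib_right mult_ac)
  moreover have "poly2_degree_le d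
      (\<lambda>x y. \<Sum>k\<le>m. \<Sum>i\<le>m - k. \<Sum>j\<le>k. e k * c (m - k) i * c k j * x ^ i * y ^ j)"
    using assms by (intro poly2_degree_le_sum poly2_degree_le_monom) auto
  ultimately show ?thesis by simp
qed

text \<open>At \<open>y = 0\<close> only the summand \<open>k = 0\<close> survives, and \<open>x = -1\<close> turns \<open>(-x)\<^sub>m\<close> into \<open>m!\<close>.\<close>

lemma eigpoly_nonzero:
  assumes "0 < \<beta>"
  shows "eigpoly m \<alpha> \<beta> (-1) 0 \<noteq> 0"
proof -
  have "eigpoly m \<alpha> \<beta> (-1) 0 = (\<Sum>k\<in>{0}. (-1) ^ k * real (m choose k)
      * pochhammer (\<beta> + real k) (m - k) * pochhammer (\<alpha> + real m - real k) k
      * pochhammer (- (-1)) (m - k) * pochhammer (- 0) k)"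
    unfolding eigpoly_def
    by (intro sum.mono_neutral_right) (auto simp: pochhammer_0_left)
  also have "\<dots> = pochhammer \<beta> m * fact m"
    by (simp add: pochhammer_fact)
  finally show ?thesis using pochhammer_pos[OF assms, of m] by simp
qed

lemma is_eigenpolynomial_eigpoly:
  assumes "m \<le> d" "0 < \<beta>"
  shows "is_eigenpolynomial d (Htilde2 \<alpha> \<beta>) (eigpoly m \<alpha> \<beta>) (eigval m \<alpha> \<beta>)"
  unfolding is_eigenpolynomial_def
  using poly2_degree_le_eigpoly[OF assms(1)] eigpoly_nonzero[OF assms(2)] Htilde2_eigpoly by blast

section \<open>Conjugation by the ground state\<close>

text \<open>
  The constant by which \<open>B\<close>, applied to \<open>\<phi>\<^sub>0(\<lambda>) p\<close>, differs from \<open>\<phi>\<^sub>0(\<lambda> + \<delta>) D p\<close>. It is \<open>0\<close> for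
  \<open>N = 0\<close>, where the truncated \<open>N - 1\<close> does not describe a smaller lattice; so \<open>Bop_gauge\<close>
  stays true there, its left-hand side being \<open>0\<close>.
\<close>

definition gauge_const :: "real \<Rightarrow> real \<Rightarrow> real \<Rightarrow> nat \<Rightarrow> real" where
  "gauge_const \<alpha> \<beta> b N = sqrt (real N * \<alpha> * \<beta>
     * pochhammer (\<alpha> + 1 + (\<beta> + 1) + b) (N - 1) / pochhammer (\<alpha> + \<beta> + b) N)"

lemma gauge_const_pos:
  assumes "0 < \<alpha>" "0 < \<beta>" "0 < b" "0 < N"
  shows "0 < gauge_const \<alpha> \<beta> b N"
  using assms by (auto simp: gauge_const_def intro!: mult_pos_pos divide_pos_pos pochhammer_pos)

lemma phi0_flip: "phi0 (\<alpha>, \<beta>, b, N) x y = phi0 (\<beta>, \<alpha>, b, N) y x"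
  by (simp add: add.commute mult_ac diff_right_commute[of N])

text \<open>
  The coefficients of \<open>B\<close> are made so that either forward shift turns \<open>\<phi>\<^sub>0(\<lambda>)\<close> into
  the same multiple of \<open>\<phi>\<^sub>0(\<lambda> + \<delta>)\<close>: under the square root, \<open>y + 1\<close> turns \<open>(y + 1)!\<close> into
  \<open>y!\<close>, while \<open>(x + \<alpha>) (\<alpha>)\<^sub>x = \<alpha> (\<alpha> + 1)\<^sub>x\<close> and \<open>(\<beta>)\<^sub>y\<^sub>+\<^sub>1 = \<beta> (\<beta> + 1)\<^sub>y\<close>. Points beyond
  the lattice boundary give \<open>0\<close> on both sides.
\<close>

lemma phi0_step_y:
  assumes "0 < \<alpha>" "0 < \<beta>" "0 < b"
  shows "sqrt (real (y + 1) * (real x + \<alpha>)) * phi0 (\<alpha>, \<beta>, b, N) x (y + 1)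
    = gauge_const \<alpha> \<beta> b N * phi0 (\<alpha> + 1, \<beta> + 1, b, N - 1) x y"
proof (cases "x + y + 1 \<le> N")
  case False
  hence "N = 0 \<or> \<not> x + y \<le> N - 1" by auto
  with False show ?thesis by (auto simp: gauge_const_def)
next
  case True
  then obtain M where N: "N = Suc M" and M: "x + y \<le> M" by (cases N) auto
  define A where "A = pochhammer (\<alpha> + 1) x"
  define B where "B = pochhammer (\<beta> + 1) y"
  define R where "R = pochhammer b (M - x - y)"
  define Z where "Z = pochhammer (\<alpha> + \<beta> + b) (Suc M)"
  define Z' where "Z' = pochhammer (\<alpha> + 1 + (\<beta> + 1) + b) M"
  have Z: "0 < Z" "0 < Z'" using assms by (auto simp: Z_def Z'_def intro!: pochhammer_pos)
  have A: "(real x + \<alpha>) * pochhammer \<alpha> x = \<alpha> * A"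
    using pochhammer_rec[of \<alpha> x] by (simp add: A_def pochhammer_Suc algebra_simps)
  have B: "pochhammer \<beta> (Suc y) = \<beta> * B" by (simp add: B_def pochhammer_rec)
  have 1: "phi0 (\<alpha>, \<beta>, b, N) x (y + 1) = sqrt (fact N / (fact x * fact (Suc y) * fact (M - x - y))
      * (pochhammer \<alpha> x * pochhammer \<beta> (Suc y) * R / Z))"
    using True by (simp add: N R_def Z_def del: fact_Suc)
  have 2: "phi0 (\<alpha> + 1, \<beta> + 1, b, N - 1) x y
      = sqrt (fact M / (fact x * fact y * fact (M - x - y)) * (A * B * R / Z'))"
    using M by (simp add: N A_def B_def R_def Z'_def)
  have 3: "gauge_const \<alpha> \<beta> b N = sqrt (real N * \<alpha> * \<beta> * Z' / Z)"
    by (simp add: gauge_const_def N Z_def Z'_def)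
  have "real (y + 1) * (real x + \<alpha>) * (fact N / (fact x * fact (Suc y) * fact (M - x - y))
      * (pochhammer \<alpha> x * pochhammer \<beta> (Suc y) * R / Z))
    = real (Suc y) * (fact N / (fact x * fact (Suc y) * fact (M - x - y))
      * (((real x + \<alpha>) * pochhammer \<alpha> x) * pochhammer \<beta> (Suc y) * R / Z))"
    by simp
  also have "\<dots> = (real N * \<alpha> * \<beta> * Z' / Z) *
      (fact M / (fact x * fact y * fact (M - x - y)) * (A * B * R / Z'))"
    unfolding A B N fact_Suc using Z by (simp add: field_simps del: of_nat_Suc)
  finally show ?thesis
    unfolding 1 2 3 real_sqrt_mult[symmetric] by (rule arg_cong)
qed

lemma phi0_step_x:
  assumes "0 < \<alpha>" "0 < \<beta>" "0 < b"
  shows "sqrt (real (x + 1) * (real y + \<beta>)) * phi0 (\<alpha>, \<beta>, b, N) (x + 1) y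
    = gauge_const \<alpha> \<beta> b N * phi0 (\<alpha> + 1, \<beta> + 1, b, N - 1) x y"
proof -
  have "gauge_const \<beta> \<alpha> b N = gauge_const \<alpha> \<beta> b N"
    by (simp add: gauge_const_def add_ac mult_ac)
  thus ?thesis
    using phi0_step_y[OF assms(2,1,3), of x y N] unfolding phi0_flip[of \<alpha>] phi0_flip[of "\<alpha> + 1"]
    by simp
qed

lemma Bop_gauge:
  assumes "0 < \<alpha>" "0 < \<beta>" "0 < b"
  shows "Bop (\<alpha>, \<beta>, b, N) (\<lambda>x y. phi0 (\<alpha>, \<beta>, b, N) x y * p (real x) (real y)) x y
    = gauge_const \<alpha> \<beta> b N * phi0 (\<alpha> + 1, \<beta> + 1, b, N - 1) x y * lower_op p (real x) (real y)"
proof -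
  have "Bop (\<alpha>, \<beta>, b, N) (\<lambda>x y. phi0 (\<alpha>, \<beta>, b, N) x y * p (real x) (real y)) x y
    = sqrt (real (y + 1) * (real x + \<alpha>)) * phi0 (\<alpha>, \<beta>, b, N) x (y + 1)
        * p (real x) (real y + 1)
      - sqrt (real (x + 1) * (real y + \<beta>)) * phi0 (\<alpha>, \<beta>, b, N) (x + 1) y
        * p (real x + 1) (real y)"
    by (simp del: phi0.simps add: add.commute)
  thus ?thesis unfolding phi0_step_x[OF assms] phi0_step_y[OF assms]
    by (simp add: lower_op_def algebra_simps del: phi0.simps)
qed

text \<open>The ground state is \<open>\<phi>\<^sub>0\<close> times the constant \<open>1\<close>, which the lowering operator kills.\<close>

lemma Bop_phi0:
  assumes "0 < \<alpha>" "0 < \<beta>" "0 < b"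
  shows "Bop (\<alpha>, \<beta>, b, N) (phi0 (\<alpha>, \<beta>, b, N)) x y = 0"
  using Bop_gauge[OF assms, of N "\<lambda>_ _. 1" x y] by (simp add: lower_op_def del: phi0.simps)

text \<open>
  Multiplying \<open>phi0_step_y\<close> and \<open>phi0_step_x\<close> by the same square root once more clears the root:
  this is the step identity read backwards from a shifted point.
\<close>

lemma BopT_gauge:
  assumes "0 < \<alpha>" "0 < \<beta>" "0 < b"
  shows "gauge_const \<alpha> \<beta> b N *
      BopT (\<alpha>, \<beta>, b, N) (\<lambda>x y. phi0 (\<alpha> + 1, \<beta> + 1, b, N - 1) x y * q (real x) (real y)) x y
    = phi0 (\<alpha>, \<beta>, b, N) x y * raise_op \<alpha> \<beta> q (real x) (real y)"
proof -
  let ?g = "gauge_const \<alpha> \<beta> b N"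
  let ?f = "phi0 (\<alpha> + 1, \<beta> + 1, b, N - 1)"
  have y: "?g * (sqrt (real y * (real x + \<alpha>)) * (?f x (y - 1) * q (real x) (real (y - 1))))
      = phi0 (\<alpha>, \<beta>, b, N) x y * (real y * (real x + \<alpha>) * q (real x) (real y - 1))"
  proof (cases y)
    case (Suc z)
    let ?r = "sqrt (real (z + 1) * (real x + \<alpha>))"
    have sq: "?r * ?r = real (z + 1) * (real x + \<alpha>)" using assms by simp
    have step: "?r * (?g * ?f x z) = ?r * ?r * phi0 (\<alpha>, \<beta>, b, N) x (z + 1)"
      by (simp only: phi0_step_y[OF assms, symmetric] mult.assoc)
    have "?r * (?g * ?f x z) * q (real x) (real z)
        = real (z + 1) * (real x + \<alpha>) * phi0 (\<alpha>, \<beta>, b, N) x (z + 1) * q (real x) (real z)"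
      by (simp only: step sq)
    thus ?thesis using Suc by (simp add: mult_ac del: phi0.simps)
  qed simp
  have x: "?g * (sqrt (real x * (real y + \<beta>)) * (?f (x - 1) y * q (real (x - 1)) (real y)))
      = phi0 (\<alpha>, \<beta>, b, N) x y * (real x * (real y + \<beta>) * q (real x - 1) (real y))"
  proof (cases x)
    case (Suc z)
    let ?r = "sqrt (real (z + 1) * (real y + \<beta>))"
    have sq: "?r * ?r = real (z + 1) * (real y + \<beta>)" using assms by simp
    have step: "?r * (?g * ?f z y) = ?r * ?r * phi0 (\<alpha>, \<beta>, b, N) (z + 1) y"
      by (simp only: phi0_step_x[OF assms, symmetric] mult.assoc)
    have "?r * (?g * ?f z y) * q (real z) (real y)
        = real (z + 1) * (real y + \<beta>) * phi0 (\<alpha>, \<beta>, b, N) (z + 1) y * q (real z) (real y)"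
      by (simp only: step sq)
    thus ?thesis using Suc by (simp add: mult_ac del: phi0.simps)
  qed simp
  show ?thesis
    by (simp only: BopT.simps raise_op_def right_diff_distrib x y)
qed

lemma BopT_scale: "BopT \<theta> (\<lambda>x y. c * f x y) x y = c * BopT \<theta> f x y"
  by (cases \<theta>) (simp add: algebra_simps)

lemma factorisation_holds:
  assumes "0 < \<alpha>" "0 < \<beta>" "0 < b"
  shows "factorisation (\<alpha>, \<beta>, b, N)"
proof -
  have "phi0 (\<alpha>, \<beta>, b, N) x y * Htilde2 \<alpha> \<beta> p (real x) (real y)
    = BopT (\<alpha>, \<beta>, b, N) (Bop (\<alpha>, \<beta>, b, N)
        (\<lambda>x y. phi0 (\<alpha>, \<beta>, b, N) x y * p (real x) (real y))) x y" for p x y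
  proof -
    have "Bop (\<alpha>, \<beta>, b, N) (\<lambda>x y. phi0 (\<alpha>, \<beta>, b, N) x y * p (real x) (real y))
      = (\<lambda>x y. gauge_const \<alpha> \<beta> b N *
          (phi0 (\<alpha> + 1, \<beta> + 1, b, N - 1) x y * lower_op p (real x) (real y)))"
      by (intro ext) (simp only: Bop_gauge[OF assms] mult.assoc)
    thus ?thesis
      by (simp only: BopT_scale BopT_gauge[OF assms] Htilde2_eq_raise_lower)
  qed
  thus ?thesis by (simp del: phi0.simps Bop.simps BopT.simps)
qed

section \<open>Shape invariance and the ladder\<close>

text \<open>
  The products of roots standing at \<open>f (x - 1) (y + 1)\<close> and \<open>f (x + 1) (y - 1)\<close> agree on both
  sides, so only the diagonal terms differ, by \<open>\<alpha> + \<beta>\<close>. It cannot be deduced from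
  \<open>lower_raise\<close> by conjugation: \<open>f\<close> is arbitrary also where the ground state vanishes.
\<close>

lemma shape_invariance_holds:
  assumes "0 < \<alpha>" "0 < \<beta>"
  shows "shape_invariance (\<alpha>, \<beta>, b, N)"
proof -
  have "Bop (\<alpha>, \<beta>, b, N) (BopT (\<alpha>, \<beta>, b, N) f) x y
      = BopT (\<alpha> + 1, \<beta> + 1, b, N - 1) (Bop (\<alpha> + 1, \<beta> + 1, b, N - 1) f) x y
        + (\<alpha> + \<beta>) * f x y" for f x y
  proof -
    let ?X = "real x" and ?Y = "real y"
    define s1 where "s1 = sqrt ((?Y + 1) * (?X + \<alpha>))"
    define s2 where "s2 = sqrt ((?X + 1) * (?Y + \<beta>))"
    define r1 where "r1 = sqrt (?Y * (?X + 1 + \<alpha>))"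
    define r2 where "r2 = sqrt (?X * (?Y + 1 + \<beta>))"
    have sq: "s1 * s1 = (?Y + 1) * (?X + \<alpha>)" "s2 * s2 = (?X + 1) * (?Y + \<beta>)"
        "r1 * r1 = ?Y * (?X + 1 + \<alpha>)" "r2 * r2 = ?X * (?Y + 1 + \<beta>)"
      using assms by (simp_all add: s1_def s2_def r1_def r2_def)
    have L: "Bop (\<alpha>, \<beta>, b, N) (BopT (\<alpha>, \<beta>, b, N) f) x y
        = s1 * (s1 * f x y - r2 * f (x - 1) (y + 1)) - s2 * (r1 * f (x + 1) (y - 1) - s2 * f x y)"
      by (simp add: s1_def s2_def r1_def r2_def add_ac)
    \<comment> \<open>The truncated \<open>y - 1\<close> and \<open>x - 1\<close> are harmless, since \<open>r1\<close> and \<open>r2\<close> vanish there.\<close>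
    have R1: "r1 * Bop (\<alpha> + 1, \<beta> + 1, b, N - 1) f x (y - 1)
        = r1 * (r1 * f x y - s2 * f (x + 1) (y - 1))"
      by (cases y) (simp_all add: s2_def r1_def add_ac)
    have R2: "r2 * Bop (\<alpha> + 1, \<beta> + 1, b, N - 1) f (x - 1) y
        = r2 * (s1 * f (x - 1) (y + 1) - r2 * f x y)"
      by (cases x) (simp_all add: s1_def r2_def add_ac)
    have R: "BopT (\<alpha> + 1, \<beta> + 1, b, N - 1) (Bop (\<alpha> + 1, \<beta> + 1, b, N - 1) f) x y
        = r1 * (r1 * f x y - s2 * f (x + 1) (y - 1)) - r2 * (s1 * f (x - 1) (y + 1) - r2 * f x y)"
      unfolding R1[symmetric] R2[symmetric] by (simp add: r1_def r2_def add_ac del: Bop.simps)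
    have "s1 * s1 + s2 * s2 = r1 * r1 + r2 * r2 + (\<alpha> + \<beta>)"
      unfolding sq by (simp add: algebra_simps)
    hence "(s1 * s1 + s2 * s2) * f x y = (r1 * r1 + r2 * r2 + (\<alpha> + \<beta>)) * f x y"
      by (rule arg_cong)
    thus ?thesis unfolding L R by (simp add: algebra_simps)
  qed
  thus ?thesis by (simp del: Bop.simps BopT.simps)
qed

lemma ladder_state_Suc:
  "ladder_state (Suc m) \<theta> = BopT \<theta> (ladder_state m (shift_par 1 \<theta>))"
proof -
  obtain \<alpha> \<beta> b N where \<theta>: "\<theta> = (\<alpha>, \<beta>, b, N)" by (cases \<theta>)
  have shift: "shift_par (Suc s) \<theta> = shift_par s (shift_par 1 \<theta>)" for s
    by (simp add: \<theta>)
  have shift_0: "shift_par 0 \<theta> = \<theta>" by (simp add: \<theta>)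
  show ?thesis
    unfolding ladder_state_def upt_conv_Cons[OF zero_less_Suc] map_Suc_upt[symmetric]
    by (simp only: foldr.simps foldr_map comp_def shift shift_0)
qed

text \<open>
  Shape invariance moves \<open>B\<close> past the first raising operator,
  \<open>B\<^sup>T B B\<^sup>T = B\<^sup>T (B'\<^sup>T B' + \<alpha> + \<beta>)\<close>, where \<open>B'\<close> belongs to the shifted parameters, and
  what remains of the ladder is an eigenstate of \<open>B'\<^sup>T B'\<close> by induction.
\<close>

lemma ladder_state_eigen:
  assumes "0 < \<alpha>" "0 < \<beta>" "0 < b"
  shows "BopT (\<alpha>, \<beta>, b, N) (Bop (\<alpha>, \<beta>, b, N) (ladder_state m (\<alpha>, \<beta>, b, N))) x y
    = eigval m \<alpha> \<beta> * ladder_state m (\<alpha>, \<beta>, b, N) x y"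
  using assms
proof (induction m arbitrary: \<alpha> \<beta> N x y)
  case 0
  have "Bop (\<alpha>, \<beta>, b, N) (phi0 (\<alpha>, \<beta>, b, N)) = (\<lambda>_ _. 0)"
    by (intro ext) (rule Bop_phi0[OF 0])
  thus ?case
    by (simp add: ladder_state_def eigval_def del: phi0.simps Bop.simps)
next
  case (Suc m)
  let ?\<theta> = "(\<alpha>, \<beta>, b, N)" and ?\<theta>' = "(\<alpha> + 1, \<beta> + 1, b, N - 1)"
  let ?L = "ladder_state m ?\<theta>'"
  have step: "ladder_state (Suc m) ?\<theta> = BopT ?\<theta> ?L"
    by (simp add: ladder_state_Suc del: BopT.simps)
  have "Bop ?\<theta> (BopT ?\<theta> ?L) u v = eigval (Suc m) \<alpha> \<beta> * ?L u v" for u v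
  proof -
    have "Bop ?\<theta> (BopT ?\<theta> ?L) u v = BopT ?\<theta>' (Bop ?\<theta>' ?L) u v + (\<alpha> + \<beta>) * ?L u v"
      using shape_invariance_holds[OF Suc.prems(1,2), of b N]
      by (simp del: Bop.simps BopT.simps)
    also have "BopT ?\<theta>' (Bop ?\<theta>' ?L) u v = eigval m (\<alpha> + 1) (\<beta> + 1) * ?L u v"
      using Suc.prems by (intro Suc.IH) auto
    finally show ?thesis by (simp add: eigval_def algebra_simps)
  qed
  hence "Bop ?\<theta> (BopT ?\<theta> ?L) = (\<lambda>u v. eigval (Suc m) \<alpha> \<beta> * ?L u v)" by (intro ext)
  thus ?case unfolding step by (simp only: BopT_scale)
qed

lemma ladder_state_eigpoly:
  assumes "0 < \<alpha>" "0 < \<beta>" "0 < b" "m \<le> N"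
  shows "\<exists>c. c \<noteq> 0 \<and> (\<forall>x y.
    eigpoly m \<alpha> \<beta> (real x) (real y) * phi0 (\<alpha>, \<beta>, b, N) x y
      = c * ladder_state m (\<alpha>, \<beta>, b, N) x y)"
  using assms
proof (induction m arbitrary: \<alpha> \<beta> N)
  case 0
  show ?case
    by (intro exI[of _ 1]) (simp add: ladder_state_def eigpoly_def del: phi0.simps)
next
  case (Suc m)
  let ?\<theta> = "(\<alpha>, \<beta>, b, N)" and ?\<theta>' = "(\<alpha> + 1, \<beta> + 1, b, N - 1)"
  let ?q = "eigpoly m (\<alpha> + 1) (\<beta> + 1)" and ?g = "gauge_const \<alpha> \<beta> b N"
  have "\<exists>c. c \<noteq> 0 \<and> (\<forall>x y. ?q (real x) (real y) * phi0 ?\<theta>' x y = c * ladder_state m ?\<theta>' x y)"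
    using Suc.prems by (intro Suc.IH) auto
  then obtain c where "c \<noteq> 0"
    and c: "\<And>x y. phi0 ?\<theta>' x y * ?q (real x) (real y) = c * ladder_state m ?\<theta>' x y"
    by (auto simp: mult.commute simp del: phi0.simps)
  have step: "ladder_state (Suc m) ?\<theta> = BopT ?\<theta> (ladder_state m ?\<theta>')"
    by (simp add: ladder_state_Suc del: BopT.simps)
  have "eigpoly (Suc m) \<alpha> \<beta> (real x) (real y) * phi0 ?\<theta> x y
      = ?g * c * ladder_state (Suc m) ?\<theta> x y" for x y
  proof -
    have "eigpoly (Suc m) \<alpha> \<beta> (real x) (real y) * phi0 ?\<theta> x y
        = phi0 ?\<theta> x y * eigpoly (Suc m) \<alpha> \<beta> (real x) (real y)"
      by (rule mult.commute)
    also have "\<dots> = ?g * BopT ?\<theta> (\<lambda>x y. phi0 ?\<theta>' x y * ?q (real x) (real y)) x y"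
      by (simp only: BopT_gauge[OF Suc.prems(1-3)] eigpoly_Suc)
    finally show ?thesis by (simp only: c BopT_scale step mult.assoc)
  qed
  moreover have "?g * c \<noteq> 0"
    using \<open>c \<noteq> 0\<close> gauge_const_pos[OF Suc.prems(1-3), of N] Suc.prems(4) by auto
  ultimately show ?case by blast
qed

section \<open>The operators in all variables\<close>

lemma tail_transfer:
  "tail n (\<lambda>l. x l - unit_vec j l + unit_vec k l) i
    = tail n x i - (if j \<in> {Suc i..n} then 1 else 0) + (if k \<in> {Suc i..n} then 1 else 0)"
  by (simp add: tail_def unit_vec_def sum.distrib sum_subtractf)

text \<open>All moves in the operator of index \<open>j\<close> take place inside the tail \<open>x\<^sub>>\<^sub>i\<close>, whose sum they keep.\<close>

lemma Htilde_lift2_eq_0: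
  assumes "i < j"
  shows "Htilde n a j (lift2 n i p) x = 0"
proof -
  have "x r * (x k + a k) * (lift2 n i p x - lift2 n i p (\<lambda>l. x l - unit_vec r l + unit_vec k l)) = 0"
    if "r \<in> {j..n}" "k \<in> {j..n} - {r}" for r k
    using that assms by (auto simp: lift2_def tail_transfer) (auto simp: unit_vec_def)
  thus ?thesis unfolding Htilde_def by (intro sum.neutral ballI) auto
qed

text \<open>
  Only the moves between position \<open>i\<close> and the tail contribute. They change
  \<open>(x\<^sub>i, x\<^sub>>\<^sub>i)\<close> by \<open>(-1, +1)\<close> or \<open>(+1, -1)\<close> regardless of the tail position involved, so the
  coefficients add up to tail sums.
\<close>

lemma Htilde_lift2:
  assumes "i < n"
  shows "Htilde n a i (lift2 n i p) x = lift2 n i (Htilde2 (a i) (tail n a i) p) x"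
proof -
  let ?T = "{Suc i..n}"
  define G where "G j k = x j * (x k + a k) *
      (lift2 n i p x - lift2 n i p (\<lambda>l. x l - unit_vec j l + unit_vec k l))" for j k
  define u v where "u = x i" and "v = tail n x i"
  have set: "{i..n} = insert i ?T" using assms by auto
  have G1: "G i k = (x k + a k) * (u * (p u v - p (u - 1) (v + 1)))" if "k \<in> ?T" for k
    using that by (auto simp: G_def lift2_def tail_transfer u_def v_def) (auto simp: unit_vec_def)
  have G2: "G j i = x j * ((u + a i) * (p u v - p (u + 1) (v - 1)))" if "j \<in> ?T" for j
    using that by (auto simp: G_def lift2_def tail_transfer u_def v_def) (auto simp: unit_vec_def)
  have G3: "G j k = 0" if "j \<in> ?T" "k \<in> ?T" for j k
    using that by (auto simp: G_def lift2_def tail_transfer) (auto simp: unit_vec_def)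
  have inner: "(\<Sum>k \<in> {i..n} - {j}. G j k) = G j i" if "j \<in> ?T" for j
  proof -
    have "{i..n} - {j} = insert i (?T - {j})" using that set by auto
    thus ?thesis using that by (simp add: G3)
  qed
  have "{i..n} - {i} = ?T" using assms by auto
  hence "Htilde n a i (lift2 n i p) x = (\<Sum>k \<in> ?T. G i k) + (\<Sum>j \<in> ?T. G j i)"
    unfolding Htilde_def G_def[symmetric] by (subst set) (simp add: inner)
  also have "(\<Sum>k \<in> ?T. G i k) = (v + tail n a i) * (u * (p u v - p (u - 1) (v + 1)))"
    by (simp add: G1 sum_distrib_right[symmetric] sum.distrib v_def tail_def)
  also have "(\<Sum>j \<in> ?T. G j i) = v * ((u + a i) * (p u v - p (u + 1) (v - 1)))"
    by (simp add: G2 sum_distrib_right[symmetric] v_def tail_def)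
  finally show ?thesis
    by (simp add: lift2_def[of n i "Htilde2 (a i) (tail n a i) p"] Htilde2_def u_def v_def mult_ac)
qed

lemma Htilde_PP:
  assumes "i < n"
  shows "Htilde n a i (PP n a i m) x = eigval m (a i) (tail n a i) * PP n a i m x"
  by (simp add: PP_def Htilde_lift2[OF assms]) (simp add: lift2_def Htilde2_eigpoly)

section \<open>Self-adjointness\<close>

lemma finite_grid: "finite (grid n N)"
proof -
  have "x l \<le> total n x" if "l \<in> {1..n}" for x :: "nat \<Rightarrow> nat" and l
    using that unfolding total_def by (intro member_le_sum) auto
  hence "grid n N \<subseteq> {x. \<forall>l. (l \<in> {1..n} \<longrightarrow> x l \<in> {..N}) \<and> (l \<notin> {1..n} \<longrightarrow> x l = 0)}"
    unfolding grid_def by (auto intro: order_trans)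
  thus ?thesis by (rule finite_subset) (intro finite_set_of_finite_funs; simp)
qed

definition move :: "nat \<Rightarrow> nat \<Rightarrow> (nat \<Rightarrow> nat) \<Rightarrow> nat \<Rightarrow> nat" where
  "move j k x = x(j := x j - 1, k := x k + 1)"

lemma real_move:
  assumes "j \<noteq> k" "0 < x j"
  shows "(\<lambda>l. real (move j k x l)) = (\<lambda>l. real (x l) - unit_vec j l + unit_vec k l)"
  using assms by (auto simp: move_def unit_vec_def fun_eq_iff of_nat_diff)

lemma move_move:
  assumes "j \<noteq> k" "0 < x j"
  shows "move k j (move j k x) = x"
  using assms by (auto simp: move_def fun_eq_iff)

lemma prod_remove2:
  assumes "finite S" "j \<in> S" "k \<in> S" "j \<noteq> k"
  shows "prod f S = f j * f k * prod f (S - {j, k})"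
proof -
  have "S - {j} - {k} = S - {j, k}" by auto
  thus ?thesis using assms by (simp add: prod.remove[of S j] prod.remove[of "S - {j}" k] mult.assoc)
qed

lemma total_move:
  assumes "j \<noteq> k" "0 < x j" "j \<in> {1..n}" "k \<in> {1..n}"
  shows "total n (move j k x) = total n x"
proof -
  have "real (total n (move j k x)) = (\<Sum>l = 1..n. real (move j k x l))"
    by (simp add: total_def)
  also have "\<dots> = (\<Sum>l = 1..n. real (x l) - unit_vec j l + unit_vec k l)"
    using fun_cong[OF real_move[of j k x, OF assms(1,2)]] by simp
  also have "\<dots> = real (total n x)"
    using assms(3,4) by (simp add: total_def sum.distrib sum_subtractf unit_vec_def)
  finally show ?thesis by simp
qed

text \<open>
  Detailed balance. The weight depends on \<open>x\<^sub>j\<close> through \<open>g\<^sub>j(x\<^sub>j) = (a\<^sub>j)\<^bsub>x\<^sub>j\<^esub> / x\<^sub>j!\<close>, up to a factor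
  depending on \<open>|x|\<close> only, and \<open>(m + 1) g\<^sub>j(m + 1) = (a\<^sub>j + m) g\<^sub>j(m)\<close>. A
  move thus trades the factor \<open>x\<^sub>j\<close> for the matching factor of the reverse move.
\<close>

lemma weight_move:
  assumes jk: "j \<noteq> k" "j \<in> {1..n}" "k \<in> {1..n}" and "0 < x j"
  shows "real (x j) * (real (x k) + a k) * weight n N a b x
    = real (move j k x k) * (real (move j k x j) + a j) * weight n N a b (move j k x)"
proof -
  define g where "g l m = pochhammer (a l) m / fact m" for l m
  define C where "C t = fact N / fact (N - t) * (pochhammer b (N - t) / pochhammer (total n a + b) N)"
    for t
  have weight: "weight n N a b z = C (total n z) * (\<Prod>l = 1..n. g l (z l))" for z
    by (simp add: weight_def C_def g_def prod_dividef mult_ac)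
  have g_Suc: "real (Suc m) * g l (Suc m) = (a l + real m) * g l m" for l m
    by (simp add: g_def pochhammer_Suc del: of_nat_Suc)
  obtain m where m: "x j = Suc m" using \<open>0 < x j\<close> gr0_implies_Suc by blast
  let ?P = "\<Prod>l \<in> {1..n} - {j, k}. g l (x l)"
  have "(\<Prod>l = 1..n. g l (x l)) = g j (Suc m) * g k (x k) * ?P"
    using jk m by (subst prod_remove2[of _ j k]) auto
  moreover have "(\<Prod>l = 1..n. g l (move j k x l)) = g j m * g k (Suc (x k)) * ?P"
    using jk m by (subst prod_remove2[of _ j k]) (auto simp: move_def)
  moreover have "total n (move j k x) = total n x"
    using assms by (intro total_move)
  ultimately have
    "real (x j) * (real (x k) + a k) * weight n N a b x
      = C (total n x) * (real (Suc m) * g j (Suc m)) * ((a k + real (x k)) * g k (x k)) * ?P"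
    "real (move j k x k) * (real (move j k x j) + a j) * weight n N a b (move j k x)
      = C (total n x) * ((a j + real m) * g j m) * (real (Suc (x k)) * g k (Suc (x k))) * ?P"
    using jk by (simp_all add: weight m move_def mult_ac add.commute del: of_nat_Suc)
  thus ?thesis by (simp only: g_Suc)
qed

text \<open>
  Substituting \<open>x \<mapsto> x - e\<^sub>j + e\<^sub>k\<close> in a sum over the lattice. This maps the points with
  \<open>x\<^sub>j > 0\<close> onto those with \<open>x\<^sub>k > 0\<close>; at the remaining points the coefficient \<open>w\<close> vanishes,
  although the shifted point may lie outside the lattice.
\<close>

lemma sum_move:
  fixes F :: "(nat \<Rightarrow> real) \<Rightarrow> (nat \<Rightarrow> real) \<Rightarrow> real"
    and a :: "nat \<Rightarrow> real" and b :: real and N :: nat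
  assumes jk: "j \<noteq> k" "j \<in> {1..n}" "k \<in> {1..n}"
  defines "w \<equiv> (\<lambda>j k x. real (x j) * (real (x k) + a k) * weight n N a b x)"
  defines "s \<equiv> (\<lambda>j k (x :: nat \<Rightarrow> nat) l. real (x l) - unit_vec j l + unit_vec k l)"
  shows "(\<Sum>x \<in> grid n N. w j k x * F (\<lambda>l. real (x l)) (s j k x))
    = (\<Sum>x \<in> grid n N. w k j x * F (s k j x) (\<lambda>l. real (x l)))"
proof -
  have move_grid: "move j k x \<in> grid n N" if "x \<in> grid n N" "0 < x j"
    "j \<noteq> k" "j \<in> {1..n}" "k \<in> {1..n}" for x j k
    using that total_move[of j k x n] unfolding grid_def by (auto simp: move_def)
  have "(\<Sum>x \<in> grid n N. w j k x * F (\<lambda>l. real (x l)) (s j k x))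
      = (\<Sum>x \<in> {x \<in> grid n N. 0 < x j}. w j k x * F (\<lambda>l. real (x l)) (s j k x))"
    using finite_grid by (intro sum.mono_neutral_right) (auto simp: w_def)
  also have "\<dots> = (\<Sum>x \<in> {x \<in> grid n N. 0 < x k}. w k j x * F (s k j x) (\<lambda>l. real (x l)))"
  proof (rule sum.reindex_bij_witness[of _ "move k j" "move j k"])
    fix x assume x: "x \<in> {x \<in> grid n N. 0 < x j}"
    have pos: "0 < move j k x k" by (simp add: move_def)
    show "move k j (move j k x) = x" using x jk by (simp add: move_move)
    show "move j k x \<in> {x \<in> grid n N. 0 < x k}" using x jk move_grid pos by auto
    have "s k j (move j k x) = (\<lambda>l. real (x l))"
      unfolding s_def using x jk pos by (subst real_move[symmetric]) (auto simp: move_move)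
    moreover have "(\<lambda>l. real (move j k x l)) = s j k x"
      unfolding s_def using x jk by (intro real_move) auto
    moreover have "w k j (move j k x) = w j k x"
      unfolding w_def using x jk by (intro weight_move[symmetric]) auto
    ultimately show "w k j (move j k x) * F (s k j (move j k x)) (\<lambda>l. real (move j k x l))
        = w j k x * F (\<lambda>l. real (x l)) (s j k x)" by simp
  next
    fix x assume x: "x \<in> {x \<in> grid n N. 0 < x k}"
    show "move j k (move k j x) = x" using x jk by (simp add: move_move)
    have "0 < move k j x j" by (simp add: move_def)
    thus "move k j x \<in> {x \<in> grid n N. 0 < x j}" using x jk move_grid[of x k j] by auto
  qed
  also have "\<dots> = (\<Sum>x \<in> grid n N. w k j x * F (s k j x) (\<lambda>l. real (x l)))"
    using finite_grid by (intro sum.mono_neutral_left) (auto simp: w_def)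
  finally show ?thesis .
qed

text \<open>
  The diagonal part of the form is symmetric at once. In the transfer part, the move from \<open>j\<close> to
  \<open>k\<close> is the transpose of the move from \<open>k\<close> to \<open>j\<close>, and the double sum contains both.
\<close>

lemma Htilde_self_adjoint:
  assumes "1 \<le> i"
  shows "inner_prod n N a b (Htilde n a i p) q = inner_prod n N a b p (Htilde n a i q)"
proof -
  define w where "w j k x = real (x j) * (real (x k) + a k) * weight n N a b x" for j k x
  define s where "s j k x = (\<lambda>l. real (x l) - unit_vec j l + unit_vec k l)"
    for j k and x :: "nat \<Rightarrow> nat"
  define D where "D f g j k
      = (\<Sum>x \<in> grid n N. w j k x * (f (\<lambda>l. real (x l)) * g (\<lambda>l. real (x l))))"
    for f g :: "(nat \<Rightarrow> real) \<Rightarrow> real" and j k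
  define Off where "Off f g j k = (\<Sum>x \<in> grid n N. w j k x * (f (s j k x) * g (\<lambda>l. real (x l))))"
    for f g :: "(nat \<Rightarrow> real) \<Rightarrow> real" and j k
  have expand: "inner_prod n N a b (Htilde n a i f) g
      = (\<Sum>j = i..n. \<Sum>k \<in> {i..n} - {j}. D f g j k) - (\<Sum>j = i..n. \<Sum>k \<in> {i..n} - {j}. Off f g j k)"
    for f g
  proof -
    have "inner_prod n N a b (Htilde n a i f) g
        = (\<Sum>x \<in> grid n N. \<Sum>j = i..n. \<Sum>k \<in> {i..n} - {j}.
            w j k x * (f (\<lambda>l. real (x l)) * g (\<lambda>l. real (x l)))
            - w j k x * (f (s j k x) * g (\<lambda>l. real (x l))))"
      unfolding inner_prod_def Htilde_def sum_distrib_right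
      by (intro sum.cong refl) (simp add: w_def s_def algebra_simps)
    also have "\<dots> = (\<Sum>j = i..n. \<Sum>k \<in> {i..n} - {j}. \<Sum>x \<in> grid n N.
            w j k x * (f (\<lambda>l. real (x l)) * g (\<lambda>l. real (x l)))
            - w j k x * (f (s j k x) * g (\<lambda>l. real (x l))))"
      by (subst sum.swap, intro sum.cong refl, subst sum.swap) (rule refl)
    finally show ?thesis by (simp only: sum_subtractf D_def Off_def)
  qed
  have D_sym: "D p q = D q p" by (intro ext) (simp add: D_def mult.commute)
  have Off_sym: "Off p q j k = Off q p k j" if "j \<in> {i..n}" "k \<in> {i..n} - {j}" for j k
    using that assms sum_move[of j k n a N b "\<lambda>x y. p y * q x"]
    by (simp add: Off_def w_def s_def mult.commute)
  have "(\<Sum>j = i..n. \<Sum>k \<in> {i..n} - {j}. Off p q j k)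
      = (\<Sum>j = i..n. \<Sum>k \<in> {i..n} - {j}. Off q p k j)"
    by (intro sum.cong refl) (rule Off_sym)
  also have "\<dots> = (\<Sum>j = i..n. \<Sum>k = i..n. if k \<noteq> j then Off q p k j else 0)"
    by (intro sum.cong refl sum.mono_neutral_cong_left) auto
  also have "\<dots> = (\<Sum>k = i..n. \<Sum>j = i..n. if k \<noteq> j then Off q p k j else 0)"
    by (rule sum.swap)
  also have "\<dots> = (\<Sum>k = i..n. \<Sum>j \<in> {i..n} - {k}. Off q p k j)"
    by (intro sum.cong refl sum.mono_neutral_cong_right) auto
  finally have "inner_prod n N a b (Htilde n a i p) q = inner_prod n N a b (Htilde n a i q) p"
    by (simp only: expand D_sym)
  thus ?thesis by (simp add: inner_prod_def mult_ac)
qed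

lemma orthogonal_of_eigenvalues:
  assumes "1 \<le> i" "\<And>x. Htilde n a i p x = E * p x" "\<And>x. Htilde n a i q x = E' * q x" "E \<noteq> E'"
  shows "inner_prod n N a b p q = 0"
proof -
  have "E * inner_prod n N a b p q = inner_prod n N a b (Htilde n a i p) q"
    by (simp add: inner_prod_def assms(2) sum_distrib_left mult_ac)
  also have "\<dots> = inner_prod n N a b p (Htilde n a i q)"
    by (rule Htilde_self_adjoint[OF assms(1)])
  also have "\<dots> = E' * inner_prod n N a b p q"
    by (simp add: inner_prod_def assms(3) sum_distrib_left mult_ac)
  finally show ?thesis using assms(4) by simp
qed

lemma inner_prod_commute: "inner_prod n N a b p q = inner_prod n N a b q p"
  by (simp add: inner_prod_def mult.commute)

lemma eigval_strict_mono:
  assumes "0 < \<alpha> + \<beta>" "m < m'"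
  shows "eigval m \<alpha> \<beta> < eigval m' \<alpha> \<beta>"
  unfolding sum_eigval[symmetric]
  using assms by (intro sum_strict_mono2[of _ _ m]) auto

lemma inner_prod_PP_same:
  assumes "i \<in> {1..n - 1}" "0 < a i + tail n a i" "m \<noteq> m'"
  shows "inner_prod n N a b (PP n a i m) (PP n a i m') = 0"
proof (rule orthogonal_of_eigenvalues)
  show "eigval m (a i) (tail n a i) \<noteq> eigval m' (a i) (tail n a i)"
    using eigval_strict_mono[OF assms(2)] assms(3) by (metis less_irrefl nat_neq_iff)
qed (use assms(1) in \<open>auto intro!: Htilde_PP\<close>)

lemma inner_prod_PP_less:
  assumes "i < j" "j \<in> {1..n - 1}" "0 < a j + tail n a j" "0 < m"
  shows "inner_prod n N a b (PP n a i m') (PP n a j m) = 0"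
proof (rule orthogonal_of_eigenvalues)
  show "Htilde n a j (PP n a i m') x = 0 * PP n a i m' x" for x
    using assms(1) by (simp add: PP_def Htilde_lift2_eq_0)
  have "eigval 0 (a j) (tail n a j) = 0" by (simp add: eigval_def)
  thus "0 \<noteq> eigval m (a j) (tail n a j)"
    using eigval_strict_mono[OF assms(3,4)] by simp
qed (use assms(2) in \<open>auto intro!: Htilde_PP\<close>)

section \<open>Assembling the statement\<close>

theorem theorem3p4:
  fixes n N :: nat and a :: "nat \<Rightarrow> real" and b :: real
  assumes "2 \<le> n" and "n < N"
    and "\<forall>l \<in> {1..n}. 0 < a l" and "0 < b"
  shows
    "(\<forall>i \<in> {1..n - 1}.
        factorisation (par n N a b i) \<and>
        (\<forall>x y. Bop (par n N a b i) (phi0 (par n N a b i)) x y = 0) \<and>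
        shape_invariance (par n N a b i) \<and>
        (\<forall>m \<le> N.
          (\<forall>x y. BopT (par n N a b i) (Bop (par n N a b i) (ladder_state m (par n N a b i))) x y =
                 (\<Sum>s<m. a i + tail n a i + 2 * real s) * ladder_state m (par n N a b i) x y) \<and>
          (\<Sum>s<m. a i + tail n a i + 2 * real s) = eigval m (a i) (tail n a i) \<and>
          (\<exists>c. c \<noteq> 0 \<and> (\<forall>x y. x + y \<le> N \<longrightarrow>
             eigpoly m (a i) (tail n a i) (real x) (real y) * phi0 (par n N a b i) x y =
             c * ladder_state m (par n N a b i) x y)) \<and>
          is_eigenpolynomial N (Htilde2 (a i) (tail n a i))
            (eigpoly m (a i) (tail n a i)) (eigval m (a i) (tail n a i)) \<and>
          (\<forall>x. Htilde n a i (PP n a i m) x =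
               lift2 n i (Htilde2 (a i) (tail n a i) (eigpoly m (a i) (tail n a i))) x) \<and>
          (\<forall>x. Htilde n a i (PP n a i m) x = eigval m (a i) (tail n a i) * PP n a i m x)) \<and>
        (\<forall>m \<le> N. \<forall>m' \<le> N. m \<noteq> m' \<longrightarrow>
          inner_prod n N a b (PP n a i m) (PP n a i m') = 0) \<and>
        (\<forall>m \<le> N. \<forall>j \<in> {i + 1..n - 1}. \<forall>x. Htilde n a j (PP n a i m) x = 0)) \<and>
     (\<forall>i \<in> {1..n - 1}. \<forall>j \<in> {1..n - 1}. i \<noteq> j \<longrightarrow>
        (\<forall>m \<in> {1..N}. inner_prod n N a b (PP n a i m) (PP n a j m) = 0))"
proof -
  have pos: "0 < a i" "0 < tail n a i" "0 < b + total n a - a i - tail n a i"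
    if i: "i \<in> {1..n - 1}" for i
  proof -
    show "0 < a i" "0 < tail n a i"
      using i assms(3) by (auto simp: tail_def intro!: sum_pos)
    have set: "{1..n} = {1..<i} \<union> insert i {Suc i..n}" using i by auto
    have "total n a = (\<Sum>l = 1..<i. a l) + (\<Sum>l \<in> insert i {Suc i..n}. a l)"
      unfolding total_def set by (rule sum.union_disjoint) auto
    hence "total n a = (\<Sum>l = 1..<i. a l) + (a i + tail n a i)"
      by (simp add: tail_def)
    moreover have "0 \<le> (\<Sum>l = 1..<i. a l)"
      using i assms(3) by (intro sum_nonneg) (auto intro: less_imp_le)
    ultimately show "0 < b + total n a - a i - tail n a i" using assms(4) by simp
  qed
  have gauge: "factorisation (par n N a b i)" "shape_invariance (par n N a b i)"
    "Bop (par n N a b i) (phi0 (par n N a b i)) x y = 0" if i: "i \<in> {1..n - 1}" for i x y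
    unfolding par_def using factorisation_holds[OF pos[OF i]] Bop_phi0[OF pos[OF i]]
      shape_invariance_holds[OF pos(1,2)[OF i]] by blast+
  have ladder: "BopT (par n N a b i) (Bop (par n N a b i) (ladder_state m (par n N a b i))) x y
      = (\<Sum>s<m. a i + tail n a i + 2 * real s) * ladder_state m (par n N a b i) x y"
    if i: "i \<in> {1..n - 1}" for i m x y
    unfolding par_def sum_eigval by (rule ladder_state_eigen[OF pos[OF i]])
  have ladder_poly: "\<exists>c. c \<noteq> 0 \<and> (\<forall>x y. x + y \<le> N \<longrightarrow>
      eigpoly m (a i) (tail n a i) (real x) (real y) * phi0 (par n N a b i) x y
        = c * ladder_state m (par n N a b i) x y)"
    if i: "i \<in> {1..n - 1}" and "m \<le> N" for i m
    using ladder_state_eigpoly[OF pos[OF i] \<open>m \<le> N\<close>] unfolding par_def by blast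
  have eigen: "is_eigenpolynomial N (Htilde2 (a i) (tail n a i))
      (eigpoly m (a i) (tail n a i)) (eigval m (a i) (tail n a i))"
    if i: "i \<in> {1..n - 1}" and "m \<le> N" for i m
    using \<open>m \<le> N\<close> pos(2)[OF i] by (rule is_eigenpolynomial_eigpoly)
  have restrict: "Htilde n a i (PP n a i m) x
      = lift2 n i (Htilde2 (a i) (tail n a i) (eigpoly m (a i) (tail n a i))) x"
    if "i \<in> {1..n - 1}" for i m x
    unfolding PP_def using that by (intro Htilde_lift2) auto
  have eigen_all: "Htilde n a i (PP n a i m) x = eigval m (a i) (tail n a i) * PP n a i m x"
    if "i \<in> {1..n - 1}" for i m x
    using that by (intro Htilde_PP) auto
  have same: "inner_prod n N a b (PP n a i m) (PP n a i m') = 0"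
    if i: "i \<in> {1..n - 1}" and "m \<noteq> m'" for i m m'
    using pos(1,2)[OF i] by (intro inner_prod_PP_same[OF i _ \<open>m \<noteq> m'\<close>]) simp
  have zero: "Htilde n a j (PP n a i m) x = 0" if "j \<in> {i + 1..n - 1}" for i j m x
    unfolding PP_def using that by (intro Htilde_lift2_eq_0) simp
  have different: "inner_prod n N a b (PP n a i m) (PP n a j m) = 0"
    if i: "i \<in> {1..n - 1}" and j: "j \<in> {1..n - 1}" and "i \<noteq> j" and m: "m \<in> {1..N}" for i j m
  proof (cases "i < j")
    case True
    thus ?thesis using pos(1,2)[OF j] m j by (intro inner_prod_PP_less) auto
  next
    case False
    hence "j < i" using \<open>i \<noteq> j\<close> by simp
    thus ?thesis using pos(1,2)[OF i] m i
      by (subst inner_prod_commute, intro inner_prod_PP_less) auto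
  qed
  show ?thesis
    by (intro conjI ballI allI impI)
      (blast intro: gauge ladder sum_eigval ladder_poly eigen restrict eigen_all same zero
        different)+
qed

end
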